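(* Let $\beta,\gamma\in(0,1)$, let the supply and demand assumptions in the context hold, and let $p_{\rm bal}\le p_L<p_H$. Put $f:=\dfrac{p_L}{p_H}$ and $\rho_c:=\dfrac{c(p_H)}{c(p_L)}$. Then in the revenue competition game (first entry: Platform 1's price, second entry: Platform 2's price): 1. $(L,L)$ is a Nash equilibrium iff $f\ge\min\{\frac{\rho_c}{\beta},1\}$ and $f\ge\min\{\frac{\rho_c}{1-\beta},1\}$. 2. $(L,H)$ is a Nash equilibrium iff $\frac1f\le\min\{\frac{1}{1-\beta},\frac1{\rho_c}\}$ and $f\le\min\{\frac{\rho_c}{1-\beta},1\}$. 3. $(H,L)$ is a Nash equilibrium iff $\frac1f\le\min\{\frac{1}{\beta},\frac1{\rho_c}\}$ and $f\le\min\{\frac{\rho_c}{\beta},1\}$. 4. $(H,H)$ is a Nash equilibrium iff $\frac1f\ge\min\{\frac{1}{1-\beta},\frac1{\rho_c}\}$ and $\frac1f\ge\min\{\frac1\beta,\frac1{\rho_c}\}$.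
   Context: Supply and demand assumptions. $w(p)>0$ (supply) and $c(p)>0$ (demand) are real-valued functions of the price $p>0$; $c$ is strictly decreasing, $w$ is strictly increasing; $0<p_L<p_H$; there is a unique price $p_{\rm bal}$ with $w(\gamma p_{\rm bal})=c(p_{\rm bal})$. Revenue game. Two platforms simultaneously choose a strategy in $\{L,H\}$, i.e. a price $p_1$ (Platform 1), $p_2$ (Platform 2) in $\{p_L,p_H\}$. Given $(p_1,p_2)$, the throughput of Platform 1 is $$N_1(p_1,p_2)=\min\Big\{w(\gamma p_1),\tfrac{\beta}{1-\beta}w(\gamma p_2),c(p_1),\tfrac{\beta}{1-\beta}c(p_2),\beta c(\min\{p_1,p_2\}),\beta w(\max\{\gamma p_1,\gamma p_2\})\Big\}$$ and the throughput of Platform 2 is $N_2(p_1,p_2)=\frac{1-\beta}{\beta}N_1(p_1,p_2)$. (These are the numbers of matched worker–customer pairs at the two platforms in the aggregate-utility-maximizing allocation of users under customer loyalty $\beta$.) The payoff of Platform $i$ is its revenue $(1-\gamma)\,p_i\,N_i(p_1,p_2)$. A pair of strategies is a (pure strategy) Nash equilibrium if no platform can strictly increase its payoff by a unilateral change of strategy. *)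

theory Defs
  imports Complex_Main
begin

datatype strategy = L | H

primrec price :: "real \<Rightarrow> real \<Rightarrow> strategy \<Rightarrow> real" where
  "price p_L p_H L = p_L"
| "price p_L p_H H = p_H"

definition throughput1 ::
  "(real \<Rightarrow> real) \<Rightarrow> (real \<Rightarrow> real) \<Rightarrow> real \<Rightarrow> real \<Rightarrow> real \<Rightarrow> real \<Rightarrow> real" where
  "throughput1 w c \<beta> \<gamma> p1 p2 =
     Min {w (\<gamma> * p1), \<beta> / (1 - \<beta>) * w (\<gamma> * p2),
          c p1, \<beta> / (1 - \<beta>) * c p2,
          \<beta> * c (min p1 p2), \<beta> * w (max (\<gamma> * p1) (\<gamma> * p2))}"

definition throughput2 ::
  "(real \<Rightarrow> real) \<Rightarrow> (real \<Rightarrow> real) \<Rightarrow> real \<Rightarrow> real \<Rightarrow> real \<Rightarrow> real \<Rightarrow> real" where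
  "throughput2 w c \<beta> \<gamma> p1 p2 = (1 - \<beta>) / \<beta> * throughput1 w c \<beta> \<gamma> p1 p2"

definition revenue1 ::
  "(real \<Rightarrow> real) \<Rightarrow> (real \<Rightarrow> real) \<Rightarrow> real \<Rightarrow> real \<Rightarrow> real \<Rightarrow> real \<Rightarrow> strategy \<Rightarrow> strategy \<Rightarrow> real"
  where
  "revenue1 w c \<beta> \<gamma> p_L p_H s1 s2 =
     (1 - \<gamma>) * price p_L p_H s1 * throughput1 w c \<beta> \<gamma> (price p_L p_H s1) (price p_L p_H s2)"

definition revenue2 ::
  "(real \<Rightarrow> real) \<Rightarrow> (real \<Rightarrow> real) \<Rightarrow> real \<Rightarrow> real \<Rightarrow> real \<Rightarrow> real \<Rightarrow> strategy \<Rightarrow> strategy \<Rightarrow> real"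
  where
  "revenue2 w c \<beta> \<gamma> p_L p_H s1 s2 =
     (1 - \<gamma>) * price p_L p_H s2 * throughput2 w c \<beta> \<gamma> (price p_L p_H s1) (price p_L p_H s2)"

text \<open>Both payoff functions take the strategy of Player 1 first and that of Player 2 second.\<close>

definition nash_equilibrium ::
  "('s \<Rightarrow> 't \<Rightarrow> real) \<Rightarrow> ('s \<Rightarrow> 't \<Rightarrow> real) \<Rightarrow> 's \<times> 't \<Rightarrow> bool" where
  "nash_equilibrium u1 u2 = (\<lambda>(s1, s2).
     \<not> (\<exists>s1'. u1 s1' s2 > u1 s1 s2) \<and> \<not> (\<exists>s2'. u2 s1 s2' > u2 s1 s2))"

definition revenue_equilibrium ::
  "(real \<Rightarrow> real) \<Rightarrow> (real \<Rightarrow> real) \<Rightarrow> real \<Rightarrow> real \<Rightarrow> real \<Rightarrow> real \<Rightarrow> strategy \<times> strategy \<Rightarrow> bool"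
  where
  "revenue_equilibrium w c \<beta> \<gamma> p_L p_H =
     nash_equilibrium (revenue1 w c \<beta> \<gamma> p_L p_H) (revenue2 w c \<beta> \<gamma> p_L p_H)"

end

theory Submission imports Defs begin

text \<open>
  Above the balance price supply exceeds demand, so every \<open>w\<close>-term in the throughput is dominated by
  a \<open>c\<close>-term and only demand matters. Writing \<open>a = c p_L\<close> and \<open>b = c p_H\<close>, the throughputs of
  Platform 1 become \<open>\<beta> a\<close> at \<open>(L,L)\<close>, \<open>\<beta> b\<close> at \<open>(H,H)\<close>, \<open>min (\<beta> a) (\<beta> / (1 - \<beta>) b)\<close> at \<open>(L,H)\<close>
  and \<open>min (\<beta> a) b\<close> at \<open>(H,L)\<close> (lemmas \<open>throughput1_cheaper\<close> and \<open>throughput1_dearer\<close>).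

  Platform 2 needs no separate computation: with loyalty \<open>\<beta>\<close> it is in the position of Platform 1
  with loyalty \<open>1 - \<beta>\<close> and the two prices exchanged (\<open>throughput2_eq_throughput1\<close>).

  So everything reduces to how Platform 1 replies to a fixed price of its opponent. Against \<open>L\<close>, the
  revenues of \<open>L\<close> and \<open>H\<close> are in the proportion \<open>f : min (\<rho>\<^sub>c / \<beta>) 1\<close>; against \<open>H\<close>, those of \<open>H\<close>
  and \<open>L\<close> are in the proportion \<open>1 / f : min (1 / (1 - \<beta>)) (1 / \<rho>\<^sub>c)\<close> (\<open>revenue1_reply\<close>). A
  pair of strategies is an equilibrium iff both platforms reply optimally, and each optimality
  condition is one inequality between the members of such a proportion.
\<close>

text \<open>
  The factor \<open>(1 - \<beta>) / \<beta>\<close> cancels the \<open>\<beta> / (1 - \<beta>)\<close> in the terms of \<open>p2\<close>, is the matching odds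
  of \<open>1 - \<beta>\<close> in the terms of \<open>p1\<close>, and turns \<open>\<beta>\<close> into \<open>1 - \<beta>\<close> in the two symmetric terms.
\<close>
lemma throughput2_eq_throughput1:
  assumes "0 < \<beta>" "\<beta> < 1"
  shows "throughput2 w c \<beta> \<gamma> p1 p2 = throughput1 w c (1 - \<beta>) \<gamma> p2 p1"
proof -
  have mono: "mono (\<lambda>x. (1 - \<beta>) / \<beta> * x)"
    using assms by (intro monoI mult_left_mono) auto
  have cancel: "(1 - \<beta>) / \<beta> * (\<beta> / (1 - \<beta>) * x) = x" "(1 - \<beta>) / \<beta> * (\<beta> * x) = (1 - \<beta>) * x" for x
    using assms by auto
  have "throughput2 w c \<beta> \<gamma> p1 p2 = Min ((\<lambda>x. (1 - \<beta>) / \<beta> * x) `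
      {w (\<gamma> * p1), \<beta> / (1 - \<beta>) * w (\<gamma> * p2), c p1, \<beta> / (1 - \<beta>) * c p2,
       \<beta> * c (min p1 p2), \<beta> * w (max (\<gamma> * p1) (\<gamma> * p2))})"
    unfolding throughput2_def throughput1_def by (rule mono_Min_commute[OF mono]) simp_all
  also have "\<dots> = Min {(1 - \<beta>) / \<beta> * w (\<gamma> * p1), w (\<gamma> * p2), (1 - \<beta>) / \<beta> * c p1, c p2,
      (1 - \<beta>) * c (min p1 p2), (1 - \<beta>) * w (max (\<gamma> * p1) (\<gamma> * p2))}"
    by (simp only: image_insert image_empty cancel)
  also have "\<dots> = throughput1 w c (1 - \<beta>) \<gamma> p2 p1"
    by (simp only: throughput1_def insert_commute min.commute[of p1] max.commute[of "\<gamma> * p1"]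
        diff_diff_eq2 add_diff_cancel_left')
  finally show ?thesis .
qed

text \<open>
  The six entries stand for those of the throughput of Platform 1, in that order; the two parts are
  the case where it is the cheaper platform and the case where it is the dearer one.
\<close>
lemma Min_of_dominated:
  fixes a :: "'a::linorder"
  shows "e \<le> a \<Longrightarrow> d \<le> b \<Longrightarrow> e \<le> c \<Longrightarrow> e \<le> f \<Longrightarrow> Min {a, b, c, d, e, f} = min e d"
    and "c \<le> a \<Longrightarrow> e \<le> b \<Longrightarrow> e \<le> d \<Longrightarrow> e \<le> f \<Longrightarrow> Min {a, b, c, d, e, f} = min e c"
  by (rule Min_eqI; auto simp: min_le_iff_disj min_def)+

locale oversupply =
  fixes w c :: "real \<Rightarrow> real" and \<gamma> p\<^sub>0 :: real
  assumes supply_ge_demand: "\<And>p. p\<^sub>0 \<le> p \<Longrightarrow> c p \<le> w (\<gamma> * p)"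
    and demand_pos: "\<And>p. p\<^sub>0 \<le> p \<Longrightarrow> 0 < c p"
    and supply_mono: "\<And>p q. p\<^sub>0 \<le> p \<Longrightarrow> p \<le> q \<Longrightarrow> w (\<gamma> * p) \<le> w (\<gamma> * q)"
    and share_pos: "0 < \<gamma>" and share_less_1: "\<gamma> < 1" and price_pos: "0 < p\<^sub>0"
begin

lemma supply_ge_demand_cheaper:
  "p\<^sub>0 \<le> p \<Longrightarrow> p \<le> q \<Longrightarrow> c p \<le> w (\<gamma> * q)"
  using supply_ge_demand[of p] supply_mono[of p q] by linarith

lemma throughput1_cheaper:
  assumes "0 < \<beta>" "\<beta> < 1" "p\<^sub>0 \<le> p" "p \<le> q"
  shows "throughput1 w c \<beta> \<gamma> p q = min (\<beta> * c p) (\<beta> / (1 - \<beta>) * c q)"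
proof -
  have max: "max (\<gamma> * p) (\<gamma> * q) = \<gamma> * q" and min: "min p q = p"
    using assms share_pos by auto
  have "\<beta> / (1 - \<beta>) * c q \<le> \<beta> / (1 - \<beta>) * w (\<gamma> * q)"
    using assms supply_ge_demand[of q] by (intro mult_left_mono) auto
  moreover have "\<beta> * c p \<le> \<beta> * w (\<gamma> * q)"
    using assms supply_ge_demand_cheaper by (intro mult_left_mono) auto
  moreover have "\<beta> * c p \<le> c p"
    using assms demand_pos[of p] by (simp add: mult_left_le_one_le)
  moreover have "c p \<le> w (\<gamma> * p)"
    using assms supply_ge_demand by simp
  ultimately show ?thesis
    unfolding throughput1_def max min by (intro Min_of_dominated(1)) linarith+
qed

lemma throughput1_dearer:
  assumes "0 < \<beta>" "\<beta> < 1" "p\<^sub>0 \<le> p" "p \<le> q"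
  shows "throughput1 w c \<beta> \<gamma> q p = min (\<beta> * c p) (c q)"
proof -
  have max: "max (\<gamma> * q) (\<gamma> * p) = \<gamma> * q" and min: "min q p = p"
    using assms share_pos by auto
  have "\<beta> \<le> \<beta> / (1 - \<beta>)"
    using assms by (simp add: field_simps)
  then have "\<beta> * c p \<le> \<beta> / (1 - \<beta>) * c p"
    using assms demand_pos[of p] by (intro mult_right_mono) auto
  moreover have "\<beta> / (1 - \<beta>) * c p \<le> \<beta> / (1 - \<beta>) * w (\<gamma> * p)"
    using assms supply_ge_demand[of p] by (intro mult_left_mono) auto
  moreover have "\<beta> * c p \<le> \<beta> * w (\<gamma> * q)"
    using assms supply_ge_demand_cheaper by (intro mult_left_mono) auto
  moreover have "c q \<le> w (\<gamma> * q)"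
    using assms supply_ge_demand by simp
  ultimately show ?thesis
    unfolding throughput1_def max min by (intro Min_of_dominated(2)) linarith+
qed

lemma throughput1_equal_prices:
  assumes "0 < \<beta>" "\<beta> < 1" "p\<^sub>0 \<le> p"
  shows "throughput1 w c \<beta> \<gamma> p p = \<beta> * c p"
proof -
  have "\<beta> * c p \<le> c p"
    using assms demand_pos[of p] by (simp add: mult_left_le_one_le)
  then show ?thesis
    using throughput1_dearer[of \<beta> p p] assms by simp
qed

text \<open>
  Both replies to a fixed opponent share a positive factor: the revenue of \<open>H\<close> against \<open>L\<close> if demand
  were still \<open>c p_L\<close>, respectively the revenue at \<open>(H,H)\<close> times \<open>f\<close>. Stating equalities with that
  factor serves both directions of comparison: a given reply may be required to be optimal, or the
  other one.
\<close>
lemma revenue1_reply: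
  assumes \<beta>: "0 < \<beta>" "\<beta> < 1" and p: "p\<^sub>0 \<le> p_L" "p_L < p_H"
  defines "f \<equiv> p_L / p_H" and "\<rho> \<equiv> c p_H / c p_L"
  defines "K \<equiv> (1 - \<gamma>) * \<beta> * p_H * c p_L" and "K' \<equiv> (1 - \<gamma>) * \<beta> * p_L * c p_H"
  shows "0 < K" "0 < K'"
    and "revenue1 w c \<beta> \<gamma> p_L p_H L L = K * f"
    and "revenue1 w c \<beta> \<gamma> p_L p_H H L = K * min (\<rho> / \<beta>) 1"
    and "revenue1 w c \<beta> \<gamma> p_L p_H H H = K' * (1 / f)"
    and "revenue1 w c \<beta> \<gamma> p_L p_H L H = K' * min (1 / (1 - \<beta>)) (1 / \<rho>)"
proof -
  have pos: "0 < p_L" "0 < p_H" "0 < c p_L" "0 < c p_H"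
    using p price_pos demand_pos[of p_L] demand_pos[of p_H] by auto
  show "0 < K" "0 < K'"
    unfolding K_def K'_def using \<beta> pos share_less_1 by simp_all
  show "revenue1 w c \<beta> \<gamma> p_L p_H L L = K * f" "revenue1 w c \<beta> \<gamma> p_L p_H H H = K' * (1 / f)"
    using \<beta> p pos by (simp_all add: revenue1_def throughput1_equal_prices K_def K'_def f_def)
  have "min (\<beta> * c p_L) (c p_H) = \<beta> * c p_L * min (\<rho> / \<beta>) 1"
    using \<beta> pos by (simp add: min_mult_distrib_left \<rho>_def min.commute)
  then show "revenue1 w c \<beta> \<gamma> p_L p_H H L = K * min (\<rho> / \<beta>) 1"
    using \<beta> p by (simp add: revenue1_def throughput1_dearer K_def)
  have "min (\<beta> * c p_L) (\<beta> / (1 - \<beta>) * c p_H) = \<beta> * c p_H * min (1 / (1 - \<beta>)) (1 / \<rho>)"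
    using \<beta> pos by (simp add: min_mult_distrib_left \<rho>_def min.commute)
  then show "revenue1 w c \<beta> \<gamma> p_L p_H L H = K' * min (1 / (1 - \<beta>)) (1 / \<rho>)"
    using \<beta> p by (simp add: revenue1_def throughput1_cheaper K'_def)
qed

lemma revenue1_compare:
  assumes "0 < \<beta>" "\<beta> < 1" "p\<^sub>0 \<le> p_L" "p_L < p_H"
  defines "R \<equiv> revenue1 w c \<beta> \<gamma> p_L p_H"
    and "f \<equiv> p_L / p_H" and "\<rho> \<equiv> c p_H / c p_L"
  shows "R H L \<le> R L L \<longleftrightarrow> min (\<rho> / \<beta>) 1 \<le> f"
    and "R L L \<le> R H L \<longleftrightarrow> f \<le> min (\<rho> / \<beta>) 1"
    and "R L H \<le> R H H \<longleftrightarrow> min (1 / (1 - \<beta>)) (1 / \<rho>) \<le> 1 / f"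
    and "R H H \<le> R L H \<longleftrightarrow> 1 / f \<le> min (1 / (1 - \<beta>)) (1 / \<rho>)"
  unfolding R_def f_def \<rho>_def
  using revenue1_reply(1,2)[OF assms(1-4)]
  by (simp_all only: revenue1_reply(3-6)[OF assms(1-4)] mult_le_cancel_left_pos)

end

lemma nash_equilibrium_iff:
  "nash_equilibrium u1 u2 (s1, s2) \<longleftrightarrow> (\<forall>s. u1 s s2 \<le> u1 s1 s2) \<and> (\<forall>s. u2 s1 s \<le> u2 s1 s2)"
  by (simp add: nash_equilibrium_def not_less)

lemma all_strategy: "(\<forall>s. P s) \<longleftrightarrow> P L \<and> P H"
  by (metis (full_types) strategy.exhaust)

theorem mainTheorem9:
  fixes w c :: "real \<Rightarrow> real" and \<beta> \<gamma> p_L p_H p_bal f \<rho>\<^sub>c :: real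
  assumes "0 < \<beta>" "\<beta> < 1" "0 < \<gamma>" "\<gamma> < 1"
    and "\<And>p. p > 0 \<Longrightarrow> w p > 0" "\<And>p. p > 0 \<Longrightarrow> c p > 0"
    and "strict_mono_on {0<..} w" "strict_antimono_on {0<..} c"
    and "p_bal > 0" "w (\<gamma> * p_bal) = c p_bal"
    and "\<And>p. p > 0 \<Longrightarrow> w (\<gamma> * p) = c p \<Longrightarrow> p = p_bal"
    and "0 < p_L" "p_L < p_H" "p_bal \<le> p_L"
    and "f = p_L / p_H" "\<rho>\<^sub>c = c p_H / c p_L"
  shows "(revenue_equilibrium w c \<beta> \<gamma> p_L p_H (L, L) \<longleftrightarrow>
            f \<ge> min (\<rho>\<^sub>c / \<beta>) 1 \<and> f \<ge> min (\<rho>\<^sub>c / (1 - \<beta>)) 1)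
       \<and> (revenue_equilibrium w c \<beta> \<gamma> p_L p_H (L, H) \<longleftrightarrow>
            1 / f \<le> min (1 / (1 - \<beta>)) (1 / \<rho>\<^sub>c) \<and> f \<le> min (\<rho>\<^sub>c / (1 - \<beta>)) 1)
       \<and> (revenue_equilibrium w c \<beta> \<gamma> p_L p_H (H, L) \<longleftrightarrow>
            1 / f \<le> min (1 / \<beta>) (1 / \<rho>\<^sub>c) \<and> f \<le> min (\<rho>\<^sub>c / \<beta>) 1)
       \<and> (revenue_equilibrium w c \<beta> \<gamma> p_L p_H (H, H) \<longleftrightarrow>
            1 / f \<ge> min (1 / (1 - \<beta>)) (1 / \<rho>\<^sub>c) \<and> 1 / f \<ge> min (1 / \<beta>) (1 / \<rho>\<^sub>c))"
proof -
  have oversupplied: "c p \<le> w (\<gamma> * p)" if "p_bal \<le> p" for p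
  proof -
    have "c p \<le> c p_bal"
      using that assms(9) monotone_onD[OF assms(8), of p_bal p]
      by (cases "p = p_bal") auto
    moreover have "w (\<gamma> * p_bal) \<le> w (\<gamma> * p)"
      using that assms(3,9) strict_mono_onD[OF assms(7), of "\<gamma> * p_bal" "\<gamma> * p"]
      by (cases "p = p_bal") auto
    ultimately show ?thesis
      using assms(10) by simp
  qed
  interpret oversupply w c \<gamma> p_bal
  proof
    show "w (\<gamma> * p) \<le> w (\<gamma> * q)" if "p_bal \<le> p" "p \<le> q" for p q
      using that assms(3,9) strict_mono_onD[OF assms(7), of "\<gamma> * p" "\<gamma> * q"]
      by (cases "p = q") auto
  qed (use oversupplied assms(3,4,6,9) in auto)
  have swap: "revenue2 w c \<beta> \<gamma> p_L p_H s1 s2 = revenue1 w c (1 - \<beta>) \<gamma> p_L p_H s2 s1" for s1 s2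
    using assms(1,2) by (simp add: revenue2_def revenue1_def throughput2_eq_throughput1)
  have \<beta>': "0 < 1 - \<beta>" "1 - \<beta> < 1" and "1 - (1 - \<beta>) = \<beta>"
    using assms(1,2) by auto
  note compare1 = revenue1_compare[OF assms(1,2,14,13), folded assms(15,16)]
  note compare2 = revenue1_compare[OF \<beta>' assms(14,13), folded assms(15,16),
      unfolded \<open>1 - (1 - \<beta>) = \<beta>\<close>]
  show ?thesis
    unfolding revenue_equilibrium_def nash_equilibrium_iff all_strategy swap compare1 compare2
    by auto
qed

end
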